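(* Let $N\ge 7$ be an odd integer and let $\ell$ be an integer with $1\le \ell\le \frac N2-1$. Then the effective resistance $R_{N,2}(\ell)$ between the vertices $0$ and $\ell$ of the graph $G_N^{(2)}$ is \[ R_{N,2}(\ell)=\frac{4}{\sqrt{4N-25}}\,\Im\left(C_N-\frac{C_N}{2}\mathcal P_\ell^{(2)}-\frac12\mathcal B_\ell^{(2)}\right), \] where $\Im(\cdot)$ denotes the imaginary part and \[ C_N:=\frac{2+\mathcal P_N^{(2)}+d\,\mathcal B_N^{(2)}}{d\left(2-\mathcal P_N^{(2)}-d\,\mathcal B_N^{(2)}\right)}. \]
   Context: For odd $N$, the graph $G_N^{(2)}$ has vertex set $\mathbb Z/N\mathbb Z$; two distinct vertices $x,y$ are adjacent iff their circular distance $\min\{|x-y|,N-|x-y|\}$ (with representatives in $\{0,\dots,N-1\}$) is at least $3$; i.e. it is $K_N$ with all edges of circular distance $1$ and $2$ deleted. For a connected graph with Laplacian matrix $L$ (degree matrix minus adjacency matrix) and Moore--Penrose pseudoinverse $L^+$, the effective resistance between vertices $x,y$ is $R(x,y)=(e_x-e_y)^*L^+(e_x-e_y)$, where $e_x$ are the standard basis vectors. Set $\tau:=\frac{-1+i\sqrt{4N-25}}{2}$, let $\rho\in\mathbb C$ be the solution of $\rho+\rho^{-1}=\tau$ with $|\rho|<1$, and let $d:=\rho-\rho^{-1}$. For $k\ge0$ define the generalized Pisa and Bejaia numbers $\mathcal P_k^{(2)}:=\rho^k+\rho^{-k}$ and $\mathcal B_k^{(2)}:=\frac{\rho^k-\rho^{-k}}{d}$.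 *)

theory Defs
  imports Complex_Main "Jordan_Normal_Form.Matrix" "Jordan_Normal_Form.Schur_Decomposition"
begin

text \<open>A simple graph on the vertex set \<open>{0..<n}\<close> is given by its adjacency relation; it is
  used only on pairs of vertices below \<open>n\<close>.\<close>

definition adjacency_mat :: "nat \<Rightarrow> (nat \<Rightarrow> nat \<Rightarrow> bool) \<Rightarrow> real mat" where
  "adjacency_mat n adj = mat n n (\<lambda>(x, y). if adj x y then 1 else 0)"

definition degree_mat :: "nat \<Rightarrow> (nat \<Rightarrow> nat \<Rightarrow> bool) \<Rightarrow> real mat" where
  "degree_mat n adj =
     mat n n (\<lambda>(x, y). if x = y then real (card {z. z < n \<and> adj x z}) else 0)"

definition laplacian_mat :: "nat \<Rightarrow> (nat \<Rightarrow> nat \<Rightarrow> bool) \<Rightarrow> real mat" where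
  "laplacian_mat n adj = degree_mat n adj - adjacency_mat n adj"

definition is_moore_penrose :: "'a :: conjugatable_field mat \<Rightarrow> 'a mat \<Rightarrow> bool" where
  "is_moore_penrose A X \<longleftrightarrow>
     X \<in> carrier_mat (dim_col A) (dim_row A) \<and>
     A * X * A = A \<and> X * A * X = X \<and>
     mat_adjoint (A * X) = A * X \<and> mat_adjoint (X * A) = X * A"

definition pseudoinverse :: "'a :: conjugatable_field mat \<Rightarrow> 'a mat" where
  "pseudoinverse A = (THE X. is_moore_penrose A X)"

text \<open>The form \<open>w \<bullet>c v\<close> is conjugate-linear in \<open>v\<close>, i.e. it is \<open>v\<^sup>* w\<close>. The effective resistance
  has its usual meaning for connected graphs only.\<close>

definition effective_resistance ::
    "nat \<Rightarrow> (nat \<Rightarrow> nat \<Rightarrow> bool) \<Rightarrow> nat \<Rightarrow> nat \<Rightarrow> real" where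
  "effective_resistance n adj x y =
     (let v = unit_vec n x - unit_vec n y
      in (pseudoinverse (laplacian_mat n adj) *\<^sub>v v) \<bullet>c v)"

text \<open>The residue classes modulo \<open>N\<close> are represented by \<open>{0..<N}\<close>.\<close>

definition circ_dist :: "nat \<Rightarrow> nat \<Rightarrow> nat \<Rightarrow> int" where
  "circ_dist N x y = min \<bar>int x - int y\<bar> (int N - \<bar>int x - int y\<bar>)"

definition adj_G2 :: "nat \<Rightarrow> nat \<Rightarrow> nat \<Rightarrow> bool" where
  "adj_G2 N x y \<longleftrightarrow> x \<noteq> y \<and> circ_dist N x y \<ge> 3"

definition R2 :: "nat \<Rightarrow> nat \<Rightarrow> real" where
  "R2 N l = effective_resistance N (adj_G2 N) 0 l"

definition tau :: "nat \<Rightarrow> complex" where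
  "tau N = (-1 + \<i> * complex_of_real (sqrt (4 * real N - 25))) / 2"

definition rho :: "nat \<Rightarrow> complex" where
  "rho N = (THE r. r \<noteq> 0 \<and> r + inverse r = tau N \<and> cmod r < 1)"

definition dd :: "nat \<Rightarrow> complex" where
  "dd N = rho N - inverse (rho N)"

definition pisa :: "nat \<Rightarrow> nat \<Rightarrow> complex" where
  "pisa N k = rho N ^ k + inverse (rho N) ^ k"

definition bejaia :: "nat \<Rightarrow> nat \<Rightarrow> complex" where
  "bejaia N k = (rho N ^ k - inverse (rho N) ^ k) / dd N"

definition CC :: "nat \<Rightarrow> complex" where
  "CC N = (2 + pisa N N + dd N * bejaia N N) / (dd N * (2 - pisa N N - dd N * bejaia N N))"

end

theory Submission
  imports Defs
begin

text \<open>Write \<open>J\<close> for the all-ones matrix. The pseudoinverse of a Laplacian \<open>L\<close> differs from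
  \<open>(L + J)\<^sup>-\<^sup>1\<close> only by a multiple of \<open>J\<close>, which is invisible to \<open>e\<^sub>x - e\<^sub>y\<close>. For \<open>G\<^sub>N\<close>, let \<open>A\<close>
  be the adjacency matrix of the \<open>N\<close>-cycle; then \<open>L + J = A\<^sup>2 + A + (N - 6) I\<close>, which factors as
  \<open>(A - \<tau> I)(A - cnj \<tau> I)\<close>. By partial fractions its inverse is \<open>Im ((A - \<tau> I)\<^sup>-\<^sup>1) / Im \<tau>\<close>, and
  the Green function of \<open>A - \<tau> I\<close> on the cycle is \<open>(\<rho>\<^sup>k + \<rho>\<^sup>N\<^sup>-\<^sup>k) / (d (1 - \<rho>\<^sup>N))\<close>, which equals
  \<open>C\<^sub>N\<close> at \<open>k = 0\<close>.\<close>

section \<open>Moore--Penrose inverses\<close>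

lemma mat_adjoint_carrier [simp]:
  "A \<in> carrier_mat n m \<Longrightarrow> mat_adjoint A \<in> carrier_mat m n"
  unfolding mat_adjoint_def by auto

lemma index_mat_adjoint:
  assumes "i < dim_col A" "j < dim_row A"
  shows "mat_adjoint A $$ (i, j) = conjugate (A $$ (j, i))"
  using assms unfolding mat_adjoint_def by (simp add: mat_of_rows_index)

lemma mat_adjoint_mult:
  assumes A: "A \<in> carrier_mat n m" and B: "B \<in> carrier_mat m k"
  shows "mat_adjoint (A * B) = mat_adjoint B * mat_adjoint A"
proof (rule eq_matI)
  have C: "mat_adjoint A \<in> carrier_mat m n" "mat_adjoint B \<in> carrier_mat k m"
    "mat_adjoint (A * B) \<in> carrier_mat k n"
    using A B by auto
  then show "dim_row (mat_adjoint (A * B)) = dim_row (mat_adjoint B * mat_adjoint A)"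
    "dim_col (mat_adjoint (A * B)) = dim_col (mat_adjoint B * mat_adjoint A)"
    by auto
  fix i j assume "i < dim_row (mat_adjoint B * mat_adjoint A)"
    and "j < dim_col (mat_adjoint B * mat_adjoint A)"
  then have ij: "i < k" "j < n" using C by auto
  have "mat_adjoint (A * B) $$ (i, j) = conjugate (\<Sum>l<m. A $$ (j, l) * B $$ (l, i))"
    using ij A B by (simp add: index_mat_adjoint scalar_prod_def lessThan_atLeast0)
  also have "\<dots> = (\<Sum>l<m. conjugate (A $$ (j, l)) * conjugate (B $$ (l, i)))"
    by (simp add: sum_conjugate conjugate_dist_mul)
  also have "\<dots> = (mat_adjoint B * mat_adjoint A) $$ (i, j)"
    using ij A B carrier_matD[OF C(1)] carrier_matD[OF C(2)]
    by (simp add: index_mat_adjoint scalar_prod_def lessThan_atLeast0 mult.commute)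
  finally show "mat_adjoint (A * B) $$ (i, j) = (mat_adjoint B * mat_adjoint A) $$ (i, j)" .
qed

text \<open>\<open>A * X\<close> and \<open>A * Y\<close> are self-adjoint and each absorbs the
  other on its left, so taking adjoints forces them to agree; the same works for
  \<open>X * A\<close> and \<open>Y * A\<close>. Then \<open>X = X * A * X\<close> can be rewritten
  into \<open>Y * A * Y = Y\<close>.\<close>

lemma is_moore_penrose_unique:
  assumes X: "is_moore_penrose A X" and Y: "is_moore_penrose A Y"
  shows "X = Y"
proof -
  define n m where "n = dim_row A" and "m = dim_col A"
  have A: "A \<in> carrier_mat n m" by (simp add: n_def m_def)
  have XC: "X \<in> carrier_mat m n" and YC: "Y \<in> carrier_mat m n"
    using X Y by (auto simp: is_moore_penrose_def n_def m_def)
  note X' = X[unfolded is_moore_penrose_def] and Y' = Y[unfolded is_moore_penrose_def]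
  have "A * X = (A * Y) * (A * X)"
    using Y' assoc_mult_mat[of "A * Y" n n A m X n] A XC YC by simp
  \<comment> \<open>The adjoint reverses the product while fixing each factor, so the order of
    \<open>X\<close> and \<open>Y\<close> is swapped.\<close>
  also have "\<dots> = mat_adjoint ((A * X) * (A * Y))"
    using X' Y' A XC YC by (subst mat_adjoint_mult[where n = n and m = n and k = n]) auto
  also have "(A * X) * (A * Y) = A * Y"
    using X' assoc_mult_mat[of "A * X" n n A m Y n] A XC YC by simp
  finally have AX: "A * X = A * Y" using Y' by simp
  have "X * A = (X * A) * (Y * A)"
    using Y' assoc_mult_mat[of X m n A m "Y * A" m] assoc_mult_mat[of A n m Y n A m] A XC YC by simp
  also have "\<dots> = mat_adjoint ((Y * A) * (X * A))"
    using X' Y' A XC YC by (subst mat_adjoint_mult[where n = m and m = m and k = m]) auto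
  also have "(Y * A) * (X * A) = Y * A"
    using X' assoc_mult_mat[of Y m n A m "X * A" m] assoc_mult_mat[of A n m X n A m] A XC YC by simp
  finally have XA: "X * A = Y * A" using Y' by simp
  have "X = X * A * X" using X' by simp
  also have "\<dots> = Y * (A * X)" using XA A XC YC by simp
  also have "\<dots> = Y * A * Y" using AX A XC YC by simp
  finally show "X = Y" using Y' by simp
qed

lemma pseudoinverse_eqI: "is_moore_penrose A X \<Longrightarrow> pseudoinverse A = X"
  unfolding pseudoinverse_def by (blast intro: is_moore_penrose_unique)

section \<open>Effective resistance through the inverse of the shifted Laplacian\<close>

definition ones_mat :: "nat \<Rightarrow> 'a :: one mat" where
  "ones_mat n = mat n n (\<lambda>_. 1)"

lemma ones_mat_carrier [simp]: "ones_mat n \<in> carrier_mat n n"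
  by (simp add: ones_mat_def)

lemma dim_ones_mat [simp]: "dim_row (ones_mat n) = n" "dim_col (ones_mat n) = n"
  by (simp_all add: ones_mat_def)

lemma index_ones_mat [simp]: "i < n \<Longrightarrow> j < n \<Longrightarrow> ones_mat n $$ (i, j) = 1"
  by (simp add: ones_mat_def)

lemma smult_smult_mat: "a \<cdot>\<^sub>m (b \<cdot>\<^sub>m A) = (a * b :: 'a :: semigroup_mult) \<cdot>\<^sub>m A"
  by (rule eq_matI) (simp_all add: mult.assoc)

lemma minus_zero_mat:
  "A \<in> carrier_mat n m \<Longrightarrow> A - 0\<^sub>m n m = (A :: 'a :: group_add mat)"
  by (rule eq_matI) auto

lemma one_smult_mat: "1 \<cdot>\<^sub>m A = (A :: 'a :: monoid_mult mat)"
  by (rule eq_matI) simp_all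

lemma ones_mat_square: "ones_mat n * ones_mat n = of_nat n \<cdot>\<^sub>m (ones_mat n :: 'a :: comm_ring_1 mat)"
  by (rule eq_matI) (auto simp: ones_mat_def scalar_prod_def)

lemma mat_adjoint_one_minus_ones_mat:
  "mat_adjoint (1\<^sub>m n - (c :: real) \<cdot>\<^sub>m ones_mat n) = 1\<^sub>m n - c \<cdot>\<^sub>m ones_mat n" (is "mat_adjoint ?M = _")
proof -
  have "mat_adjoint ?M \<in> carrier_mat n n"
    by (intro mat_adjoint_carrier minus_carrier_mat smult_carrier_mat ones_mat_carrier)
  then show ?thesis
    by (intro eq_matI) (auto simp: index_mat_adjoint ones_mat_def)
qed

text \<open>On the all-ones vector \<open>L + J\<close> acts as \<open>n\<close>, hence
  \<open>K\<close> as \<open>1 / n\<close>; since \<open>J\<close> also acts as \<open>n\<close>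
  there, subtracting \<open>J / n^2\<close> makes the result vanish on it. Both products with
  \<open>L\<close> then equal the orthogonal projection \<open>?E\<close>, which is
  self-adjoint.\<close>

lemma is_moore_penrose_shifted_inverse:
  fixes L K :: "real mat"
  assumes n: "n > 0"
    and L: "L \<in> carrier_mat n n" and K: "K \<in> carrier_mat n n"
    and LJ: "L * ones_mat n = 0\<^sub>m n n" and JL: "ones_mat n * L = 0\<^sub>m n n"
    and LK: "(L + ones_mat n) * K = 1\<^sub>m n"
  shows "is_moore_penrose L (K - (1 / real n ^ 2) \<cdot>\<^sub>m ones_mat n)"
proof -
  let ?J = "ones_mat n :: real mat"
  let ?c = "1 / real n ^ 2"
  let ?E = "1\<^sub>m n - (1 / real n) \<cdot>\<^sub>m ?J"
  let ?X = "K - ?c \<cdot>\<^sub>m ?J"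
  have J: "?J \<in> carrier_mat n n" by simp
  have JJ: "?J * ?J = real n \<cdot>\<^sub>m ?J" by (rule ones_mat_square)
  have KL: "K * (L + ?J) = 1\<^sub>m n"
    using mat_mult_left_right_inverse[OF _ K LK] L by simp
  have LJ': "(L + ?J) * ?J = real n \<cdot>\<^sub>m ?J"
    using L LJ JJ by (simp add: add_mult_distrib_mat[where nr = n and n = n and nc = n])
  have JL': "?J * (L + ?J) = real n \<cdot>\<^sub>m ?J"
    using L JL JJ by (simp add: mult_add_distrib_mat[where nr = n and n = n and nc = n])
  have "?J = K * ((L + ?J) * ?J)"
    using KL K L left_mult_one_mat[OF J] assoc_mult_mat[of K n n "L + ?J" n ?J n] by simp
  also have "\<dots> = real n \<cdot>\<^sub>m (K * ?J)"
    unfolding LJ' using K by (simp add: mult_smult_distrib[where nr = n and n = n and nc = n])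
  finally have "(1 / real n) \<cdot>\<^sub>m ?J = (1 / real n) \<cdot>\<^sub>m (real n \<cdot>\<^sub>m (K * ?J))" by simp
  then have KJ: "K * ?J = (1 / real n) \<cdot>\<^sub>m ?J"
    using n by (simp add: smult_smult_mat one_smult_mat)
  have "?J = (?J * (L + ?J)) * K"
    using LK K L right_mult_one_mat[OF J] assoc_mult_mat[of ?J n n "L + ?J" n K n] by simp
  also have "\<dots> = real n \<cdot>\<^sub>m (?J * K)"
    unfolding JL' using K by (simp add: mult_smult_assoc_mat[where nr = n and n = n and nc = n])
  finally have "(1 / real n) \<cdot>\<^sub>m ?J = (1 / real n) \<cdot>\<^sub>m (real n \<cdot>\<^sub>m (?J * K))" by simp
  then have JK: "?J * K = (1 / real n) \<cdot>\<^sub>m ?J"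
    using n by (simp add: smult_smult_mat one_smult_mat)
  have X: "?X \<in> carrier_mat n n" and E: "?E \<in> carrier_mat n n"
    by (intro minus_carrier_mat smult_carrier_mat J)+
  have "L * K + ?J * K = 1\<^sub>m n"
    using LK L K by (simp add: add_mult_distrib_mat[where nr = n and n = n and nc = n])
  then have "L * K = ?E"
    unfolding JK using L K by (auto simp: mat_eq_iff algebra_simps)
  then have LX: "L * ?X = ?E"
    using L K LJ minus_zero_mat[OF E]
    by (simp add: mult_minus_distrib_mat[where nr = n and n = n and nc = n]
        mult_smult_distrib[where nr = n and n = n and nc = n])
  have "K * L + K * ?J = 1\<^sub>m n"
    using KL L K by (simp add: mult_add_distrib_mat[where nr = n and n = n and nc = n])
  then have "K * L = ?E"
    unfolding KJ using L K by (auto simp: mat_eq_iff algebra_simps)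
  then have XL: "?X * L = ?E"
    using L K JL minus_zero_mat[OF E]
    by (simp add: minus_mult_distrib_mat[where nr = n and n = n and nc = n]
        mult_smult_assoc_mat[where nr = n and n = n and nc = n])
  \<comment> \<open>This fixes the constant: \<open>J * K = J / n\<close> and
    \<open>J * (c J) = c n J\<close> cancel exactly for \<open>c = 1 / n^2\<close>.\<close>
  have JX: "?J * ?X = 0\<^sub>m n n"
    using K n
    by (simp add: mult_minus_distrib_mat[where nr = n and n = n and nc = n]
        mult_smult_distrib[where nr = n and n = n and nc = n] JK JJ smult_smult_mat power2_eq_square)
  have "L * ?X * L = L"
    unfolding LX using L JL minus_zero_mat[OF L]
    by (simp add: minus_mult_distrib_mat[where nr = n and n = n and nc = n]
        mult_smult_assoc_mat[where nr = n and n = n and nc = n])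
  moreover have "?X * L * ?X = ?X"
    unfolding XL using X JX minus_zero_mat[OF X]
    by (simp add: minus_mult_distrib_mat[where nr = n and n = n and nc = n]
        mult_smult_assoc_mat[where nr = n and n = n and nc = n])
  ultimately show ?thesis
    using L X unfolding is_moore_penrose_def
    by (simp add: LX XL mat_adjoint_one_minus_ones_mat)
qed

lemma laplacian_mat_carrier [simp]: "laplacian_mat n adj \<in> carrier_mat n n"
  by (simp add: laplacian_mat_def degree_mat_def adjacency_mat_def minus_carrier_mat)

text \<open>Writing the degree as a sum of indicators lets it cancel against the adjacency entries
  in row sums.\<close>

lemma index_laplacian_mat:
  assumes "x < n" "y < n"
  shows "laplacian_mat n adj $$ (x, y) =
    (if x = y then \<Sum>z<n. of_bool (adj x z) else 0) - of_bool (adj x y)"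
proof -
  have "real (card {z. z < n \<and> adj x z}) = (\<Sum>z<n. of_bool (adj x z))"
    by (simp add: of_bool_def sum.If_cases Int_def)
  then show ?thesis
    using assms by (auto simp: laplacian_mat_def degree_mat_def adjacency_mat_def)
qed

lemma dim_laplacian_mat [simp]:
  "dim_row (laplacian_mat n adj) = n" "dim_col (laplacian_mat n adj) = n"
  using laplacian_mat_carrier by blast+

lemma laplacian_mult_ones: "laplacian_mat n adj * ones_mat n = 0\<^sub>m n n"
proof -
  have "(\<Sum>z<n. laplacian_mat n adj $$ (x, z)) = 0" if "x < n" for x
    using that by (simp add: index_laplacian_mat sum_subtractf)
  then show ?thesis
    by (intro eq_matI)
      (auto simp: ones_mat_def scalar_prod_def lessThan_atLeast0)
qed

lemma ones_mult_laplacian: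
  assumes sym: "\<And>x y. x < n \<Longrightarrow> y < n \<Longrightarrow> adj x y \<longleftrightarrow> adj y x"
  shows "ones_mat n * laplacian_mat n adj = 0\<^sub>m n n"
proof -
  have "(\<Sum>z<n. laplacian_mat n adj $$ (z, y)) = 0" if "y < n" for y
    using that sym by (simp add: index_laplacian_mat sum_subtractf)
  then show ?thesis
    by (intro eq_matI) (auto simp: ones_mat_def scalar_prod_def lessThan_atLeast0)
qed

text \<open>The quadratic form takes four entries with signs +, -, -, +, in which the constant
  correction between \<open>K\<close> and the pseudoinverse cancels. It thus suffices to exhibit a
  right inverse of \<open>L + J\<close>.\<close>

lemma effective_resistance_shifted_inverse:
  fixes K :: "real mat"
  assumes x: "x < n" and y: "y < n"
    and sym: "\<And>x y. x < n \<Longrightarrow> y < n \<Longrightarrow> adj x y \<longleftrightarrow> adj y x"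
    and K: "K \<in> carrier_mat n n"
    and LK: "(laplacian_mat n adj + ones_mat n) * K = 1\<^sub>m n"
  shows "effective_resistance n adj x y = K $$ (x, x) - K $$ (x, y) - K $$ (y, x) + K $$ (y, y)"
proof -
  define v :: "real vec" where "v = unit_vec n x - unit_vec n y"
  define X where "X = K - (1 / real n ^ 2) \<cdot>\<^sub>m ones_mat n"
  have X: "X \<in> carrier_mat n n"
    unfolding X_def by (intro minus_carrier_mat smult_carrier_mat ones_mat_carrier)
  have v: "v \<in> carrier_vec n" by (simp add: v_def)
  have "is_moore_penrose (laplacian_mat n adj) X"
    unfolding X_def
    using x K LK sym
    by (intro is_moore_penrose_shifted_inverse laplacian_mult_ones ones_mult_laplacian) auto
  then have "effective_resistance n adj x y = (X *\<^sub>v v) \<bullet> v"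
    by (simp add: effective_resistance_def Let_def pseudoinverse_eqI v_def)
  also have "\<dots> = (X *\<^sub>v v) $ x - (X *\<^sub>v v) $ y"
  proof -
    have "X *\<^sub>v v \<in> carrier_vec n" using X v by simp
    then show ?thesis
      using x y by (simp add: v_def scalar_prod_minus_distrib[of _ n])
  qed
  also have "\<dots> = X $$ (x, x) - X $$ (x, y) - X $$ (y, x) + X $$ (y, y)"
    using x y X by (simp add: v_def scalar_prod_minus_distrib[of _ n])
  finally show ?thesis
    using x y K by (simp add: X_def)
qed

section \<open>Circulant structure of the graph\<close>

lemma adj_G2_sym: "adj_G2 N x y \<longleftrightarrow> adj_G2 N y x"
  by (auto simp: adj_G2_def circ_dist_def abs_minus_commute)

text \<open>The vertices not adjacent to \<open>x\<close>, itself included, are the five residues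
  \<open>x - 2, ..., x + 2\<close>. They are distinct modulo \<open>N\<close>, so the sum is 0 or 1.
  The divisibility form lets sums over vertices be evaluated one shift at a time.\<close>

lemma of_bool_adj_G2:
  assumes "N \<ge> 7" "x < N" "y < N"
  shows "of_bool (adj_G2 N x y) =
    (1 :: real) - (\<Sum>d\<in>{-2..2}. of_bool (int N dvd int y - int x - d))"
proof -
  define n z where "n = int N" and "z = int y - int x"
  have z: "\<bar>z\<bar> < n" "n \<ge> 7" using assms by (auto simp: n_def z_def)
  \<comment> \<open>Since \<open>\<bar>z - d\<bar> < n + 2 < 2 * n\<close>, the quotient can only be
    -1, 0 or 1.\<close>
  have dvd: "n dvd z - d \<longleftrightarrow> z = d \<or> z = d + n \<or> z = d - n" if "\<bar>d\<bar> \<le> 2" for d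
  proof
    assume "n dvd z - d"
    then obtain k where k: "z - d = n * k" by (rule dvdE)
    have "\<bar>n * k\<bar> < n * 2" using z that k by linarith
    then have "\<bar>k\<bar> < 2" using z by (simp add: abs_mult)
    then have "k = -1 \<or> k = 0 \<or> k = 1" by linarith
    then show "z = d \<or> z = d + n \<or> z = d - n" using k by auto
  qed auto
  have adj: "adj_G2 N x y \<longleftrightarrow> z \<noteq> 0 \<and> \<bar>z\<bar> \<ge> 3 \<and> n - \<bar>z\<bar> \<ge> 3"
    by (auto simp: adj_G2_def circ_dist_def n_def z_def)
  have "of_bool (adj_G2 N x y) = (1 :: real) - (\<Sum>d\<in>{-2..2}. of_bool (n dvd z - d))"
  proof (cases "\<exists>c\<in>{-2..2}. n dvd z - c")
    case True
    then obtain c where c: "c \<in> {-2..2}" "n dvd z - c" by blast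
    then have zc: "z = c \<or> z = c + n \<or> z = c - n" using dvd[of c] by auto
    \<comment> \<open>Two shifts in the window differ by at most 4, less than \<open>n\<close>, so
      they are congruent only when equal.\<close>
    have "n dvd z - d \<longleftrightarrow> d = c" if "d \<in> {-2..2}" for d
    proof
      assume "n dvd z - d"
      then have "z = d \<or> z = d + n \<or> z = d - n" using dvd[of d] that by auto
      then show "d = c" using zc z(2) c(1) that by (elim disjE) auto
    qed (use c in simp)
    then have "(\<Sum>d\<in>{-2..2}. of_bool (n dvd z - d) :: real) = (\<Sum>d\<in>{-2..2}. if d = c then 1 else 0)"
      by (intro sum.cong) auto
    also have "\<dots> = 1" using c by simp
    moreover have "\<not> adj_G2 N x y"
      unfolding adj using zc z c(1) by auto
    ultimately show ?thesis by simp
  next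
    case False
    then have ndvd: "\<not> n dvd z - d" if "d \<in> {-2..2}" for d using that by blast
    have "adj_G2 N x y"
    proof -
      \<comment> \<open>If one of these numbers lay in the window, taking it as \<open>d\<close>
        would make \<open>z - d\<close> equal to 0, \<open>n\<close> or \<open>-n\<close>.\<close>
      have "z \<notin> {-2..2}" "z - n \<notin> {-2..2}" "z + n \<notin> {-2..2}"
        using ndvd[of z] ndvd[of "z - n"] ndvd[of "z + n"] by auto
      then show ?thesis
        unfolding adj atLeastAtMost_iff using z by linarith
    qed
    then show ?thesis using ndvd by simp
  qed
  then show ?thesis by (simp add: n_def z_def)
qed

text \<open>Exactly one \<open>k < N\<close> represents the class of \<open>m\<close>, and
  periodicity carries the value of \<open>f\<close> there back to \<open>m\<close>.\<close>

lemma sum_residue_class: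
  fixes f :: "int \<Rightarrow> 'a :: semiring_1"
  assumes N: "N > 0" and per: "\<And>m. f (m mod int N) = f m"
  shows "(\<Sum>k<N. of_bool (int N dvd int k - m) * f (int k)) = f m"
proof -
  define r where "r = nat (m mod int N)"
  have r: "r < N" "int r = m mod int N"
    using N by (auto simp: r_def nat_less_iff)
  have "int N dvd int k - m \<longleftrightarrow> k = r" if "k < N" for k
    using that r(2) by (auto simp: mod_eq_dvd_iff [symmetric])
  then have "(\<Sum>k<N. of_bool (int N dvd int k - m) * f (int k)) = (\<Sum>k<N. if k = r then f (int k) else 0)"
    by (intro sum.cong) auto
  also have "\<dots> = f m" using r per by simp
  finally show ?thesis .
qed

text \<open>This is a row of \<open>A^2 + A + (N - 6) I\<close> for the cycle adjacency matrix
  \<open>A\<close>: the square contributes the shifts by 2 and twice the identity, whence the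
  coefficient \<open>N - 4\<close>.\<close>

lemma sum_shifted_laplacian_G2:
  fixes f :: "int \<Rightarrow> real"
  assumes N: "N \<ge> 7" and x: "x < N" and per: "\<And>m. f (m mod int N) = f m"
  shows "(\<Sum>k<N. (laplacian_mat N (adj_G2 N) + ones_mat N) $$ (x, k) * f (int k)) =
    (real N - 4) * f (int x) + f (int x - 1) + f (int x + 1) + f (int x - 2) + f (int x + 2)"
proof -
  let ?D = "{-2, -1, 0, 1, 2 :: int}"
  have D: "{-2..2} = ?D" by auto
  have res: "(\<Sum>k<N. of_bool (int N dvd int k - int x - d) * g (int k)) = g (int x + d)"
    if "\<And>m. g (m mod int N) = g m" for g :: "int \<Rightarrow> real" and d
    using sum_residue_class[of N g "int x + d"] N that by (simp add: diff_diff_eq)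
  have 0: "(\<Sum>z<N. \<Sum>d\<in>?D. of_bool (int N dvd int z - int x - d) :: real) = (\<Sum>d\<in>?D. 1)"
    by (subst sum.swap) (use res[of "\<lambda>_. 1"] in simp)
  have deg: "(\<Sum>z<N. of_bool (adj_G2 N x z) :: real) = real N - 5"
  proof -
    have "(\<Sum>z<N. of_bool (adj_G2 N x z) :: real) =
        (\<Sum>z<N. 1 - (\<Sum>d\<in>?D. of_bool (int N dvd int z - int x - d)))"
      using of_bool_adj_G2[OF N x] by (intro sum.cong refl) (simp only: D lessThan_iff)
    also note sum_subtractf
    also note 0
    finally show ?thesis by simp
  qed
  \<comment> \<open>Adding \<open>J\<close> cancels the 1 in \<open>of_bool_adj_G2\<close>, leaving
    the window indicator plus the degree on the diagonal.\<close>
  have entry: "(laplacian_mat N (adj_G2 N) + ones_mat N) $$ (x, k) =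
    (if x = k then real N - 5 else 0) + (\<Sum>d\<in>?D. of_bool (int N dvd int k - int x - d))"
    if "k < N" for k
    using index_laplacian_mat[OF x that, of "adj_G2 N", unfolded deg]
      of_bool_adj_G2[OF N x that, unfolded D] x that
    by (simp del: sum.insert)
  have "(\<Sum>k<N. (laplacian_mat N (adj_G2 N) + ones_mat N) $$ (x, k) * f (int k)) =
    (\<Sum>k<N. (if x = k then (real N - 5) * f (int k) else 0) +
       (\<Sum>d\<in>?D. of_bool (int N dvd int k - int x - d) * f (int k)))"
    by (intro sum.cong refl) (simp add: entry distrib_right sum_distrib_right del: sum.insert)
  also have "\<dots> = (real N - 5) * f (int x) + (\<Sum>d\<in>?D. f (int x + d))"
  proof -
    have "(\<Sum>k<N. \<Sum>d\<in>?D. of_bool (int N dvd int k - int x - d) * f (int k)) =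
        (\<Sum>d\<in>?D. \<Sum>k<N. of_bool (int N dvd int k - int x - d) * f (int k))"
      by (rule sum.swap)
    also have "\<dots> = (\<Sum>d\<in>?D. f (int x + d))"
      by (intro sum.cong refl res per)
    finally show ?thesis
      using x by (simp add: sum.distrib del: sum.insert)
  qed
  also have "\<dots> = (real N - 4) * f (int x) + f (int x - 1) + f (int x + 1) + f (int x - 2) + f (int x + 2)"
    by (simp add: algebra_simps)
  finally show ?thesis .
qed

section \<open>The Green function of the cycle\<close>

lemma rho_props:
  assumes N: "N \<ge> 7"
  shows "rho N \<noteq> 0" "rho N + inverse (rho N) = tau N" "cmod (rho N) < 1"
proof -
  have im: "Im (tau N) \<noteq> 0" using N by (simp add: tau_def)
  define P where "P r \<longleftrightarrow> r \<noteq> 0 \<and> r + inverse r = tau N \<and> cmod r < 1" for r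
  \<comment> \<open>The solutions of \<open>r + inverse r = tau N\<close> are the roots of
    \<open>r^2 - tau N * r + 1\<close>; their product is 1, so one is the inverse of the
    other.\<close>
  define s where "s = csqrt (tau N ^ 2 - 4)"
  define r where "r = (tau N + s) / 2"
  have s2: "s ^ 2 = tau N ^ 2 - 4" by (simp add: s_def)
  have r1: "r * (tau N - r) = 1"
    using s2 by (simp add: r_def field_simps power2_eq_square)
  then have r0: "r \<noteq> 0" by auto
  then have ri: "inverse r = tau N - r" using r1 by (simp add: inverse_unique)
  \<comment> \<open>On the unit circle \<open>r + inverse r\<close> would be twice the real part of
    \<open>r\<close>, but \<open>tau N\<close> is not real.\<close>
  have n1: "cmod r \<noteq> 1"
  proof
    assume a: "cmod r = 1"
    then have "inverse r = cnj r"
      by (simp add: inverse_unique flip: complex_norm_square)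
    then have "tau N = r + cnj r" using ri by (simp add: algebra_simps)
    then show False using im by simp
  qed
  have ex: "P r \<or> P (inverse r)"
  proof (cases "cmod r < 1")
    case True then show ?thesis using r0 ri by (simp add: P_def)
  next
    case False
    then have "cmod (inverse r) < 1" using n1 by (simp add: norm_inverse inverse_less_1_iff)
    moreover have "r + inverse r = tau N" using ri by simp
    ultimately have "P (inverse r)" using r0 unfolding P_def by (simp add: add.commute)
    then show ?thesis ..
  qed
  have un: "a = b" if "P a" "P b" for a b
  proof (rule ccontr)
    assume ne: "a \<noteq> b"
    \<comment> \<open>Distinct solutions would have product 1, impossible inside the open unit
      disc.\<close>
    have "(a - b) * (a * b - 1) = 0"
    proof -
      have nz: "a \<noteq> 0" "b \<noteq> 0" and "a + inverse a = b + inverse b"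
        using that by (simp_all add: P_def)
      moreover have "(a - b) * (a * b - 1) = a * b * ((a + inverse a) - (b + inverse b))"
        using nz by (simp add: field_simps)
      ultimately show ?thesis by simp
    qed
    then have "cmod (a * b) = 1" using ne by simp
    moreover have "cmod (a * b) < 1 * 1"
      unfolding norm_mult using that by (intro mult_strict_mono') (auto simp: P_def)
    ultimately show False by simp
  qed
  have "\<exists>!r. P r" using ex un by blast
  then have "P (rho N)" unfolding rho_def P_def by (rule theI')
  then show "rho N \<noteq> 0" "rho N + inverse (rho N) = tau N" "cmod (rho N) < 1"
    by (auto simp: P_def)
qed

text \<open>The discriminant of \<open>x^2 + x + (N - 6)\<close> is \<open>25 - 4 * N\<close>, which
  is negative here. This relation makes the terms in \<open>G\<close> itself vanish in
  \<open>Im_cyclic_green_recurrence\<close>.\<close>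

lemma tau_quadratic:
  assumes "N \<ge> 7"
  shows "tau N ^ 2 + tau N + of_nat N - 6 = 0"
proof -
  define s where "s = complex_of_real (sqrt (4 * real N - 25))"
  have "s ^ 2 = of_real (sqrt (4 * real N - 25) ^ 2)" by (simp add: s_def)
  also have "sqrt (4 * real N - 25) ^ 2 = 4 * real N - 25" using assms by simp
  finally have "s ^ 2 = of_real (4 * real N - 25)" .
  moreover have "tau N ^ 2 + tau N + of_nat N - 6 = (of_real (4 * real N - 25) - s ^ 2) / 4"
    unfolding tau_def s_def[symmetric] by (simp add: power2_eq_square field_simps)
  ultimately show ?thesis by simp
qed

lemma dd_nonzero:
  assumes "N \<ge> 7"
  shows "dd N \<noteq> 0"
proof
  assume "dd N = 0"
  then have "rho N * rho N = 1"
    using rho_props(1)[OF assms] by (simp add: dd_def field_simps)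
  then have "cmod (rho N) * cmod (rho N) = 1" by (metis norm_mult norm_one)
  moreover have "cmod (rho N) * cmod (rho N) < 1 * 1"
    using rho_props(3)[OF assms] by (intro mult_strict_mono') auto
  ultimately show False by simp
qed

lemma rho_power_neq_1:
  assumes "N \<ge> 7"
  shows "rho N ^ N \<noteq> 1"
proof
  assume "rho N ^ N = 1"
  then have "cmod (rho N) ^ N = 1" by (metis norm_power norm_one)
  moreover have "cmod (rho N) ^ N < 1"
    using rho_props(3)[OF assms] assms by (simp add: power_less_one_iff)
  ultimately show False by simp
qed

section \<open>The Green function and its recurrences\<close>

definition green :: "nat \<Rightarrow> nat \<Rightarrow> complex" where
  "green N k = (rho N ^ k + rho N ^ (N - k)) / (dd N * (1 - rho N ^ N))"

text \<open>The \<open>N\<close>-periodic extension to all integers, so that shifts by 1 and 2 need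
  no wrap-around cases.\<close>

definition cyclic_green :: "nat \<Rightarrow> int \<Rightarrow> complex" where
  "cyclic_green N m = green N (nat (m mod int N))"

text \<open>The endpoint \<open>k = N\<close> is included because
  \<open>green N N = green N 0\<close>; the recurrence at \<open>N - 1\<close> reaches it.\<close>

lemma cyclic_green_of_nat:
  assumes "k \<le> N"
  shows "cyclic_green N (int k) = green N k"
  using assms by (cases "k = N") (auto simp: cyclic_green_def green_def)

lemma cyclic_green_minus_of_nat:
  assumes "k \<le> N"
  shows "cyclic_green N (- int k) = green N k"
proof -
  have "cyclic_green N (- int k) = cyclic_green N (int (N - k))"
    unfolding cyclic_green_def using assms by (simp add: of_nat_diff)
  also have "\<dots> = green N k"
    using assms by (simp only: cyclic_green_of_nat diff_le_self) (simp add: green_def add.commute)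
  finally show ?thesis .
qed

text \<open>Powers of \<open>rho N\<close> and of its inverse both solve the recurrence, as
  \<open>rho N + inverse (rho N) = tau N\<close>; away from the source \<open>green\<close> is a
  combination of the two.\<close>

lemma green_recurrence:
  assumes N: "N \<ge> 7" and k: "0 < k" "k < N"
  shows "green N (k + 1) + green N (k - 1) = tau N * green N k"
proof -
  obtain a where a: "k = Suc a" using k by (cases k) auto
  obtain b where b: "N = k + Suc b" using k less_iff_Suc_add by auto
  have "rho N ^ (k + 1) + rho N ^ (N - (k + 1)) + (rho N ^ (k - 1) + rho N ^ (N - (k - 1))) =
    tau N * (rho N ^ k + rho N ^ (N - k))"
    using rho_props(1)[OF N] unfolding rho_props(2)[OF N, symmetric]
    by (simp add: a b[unfolded a] field_simps)
  then show ?thesis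
    unfolding green_def by (simp add: add_divide_distrib[symmetric])
qed

lemma cyclic_green_recurrence:
  assumes N: "N \<ge> 7"
  shows "cyclic_green N (m + 1) + cyclic_green N (m - 1) =
    tau N * cyclic_green N m + of_bool (int N dvd m)"
proof -
  define k where "k = nat (m mod int N)"
  have k: "k < N" "m mod int N = int k"
    using N by (auto simp: k_def nat_less_iff)
  have shift: "cyclic_green N (m + d) = cyclic_green N (int k + d)" for d
    unfolding cyclic_green_def k(2)[symmetric] by (simp add: mod_add_left_eq)
  have m: "cyclic_green N m = green N k" using k by (simp add: cyclic_green_def)
  have dvd: "int N dvd m \<longleftrightarrow> k = 0" using k(2) by (simp add: dvd_eq_mod_eq_0)
  have p: "cyclic_green N (m + 1) = green N (k + 1)"
    using shift[of 1] cyclic_green_of_nat[of "k + 1" N] k by (simp add: add.commute)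
  show ?thesis
  proof (cases "k = 0")
    case True
    have "cyclic_green N (m - 1) = green N 1"
      using shift[of "-1"] cyclic_green_minus_of_nat[of 1 N] True N by simp
    moreover have "green N 1 + green N 1 = tau N * green N 0 + 1"
    proof -
      have nz: "dd N * (1 - rho N ^ N) \<noteq> 0"
        using dd_nonzero[OF N] rho_power_neq_1[OF N] by simp
      obtain b where b: "N = Suc b" using N by (cases N) auto
      \<comment> \<open>From \<open>tau N + dd N = 2 * rho N\<close> and
        \<open>tau N - dd N = 2 * inverse (rho N)\<close>. The excess is the denominator of
        \<open>green\<close>, which normalises the source to 1.\<close>
      have "2 * (rho N + rho N ^ (N - 1)) =
          tau N * (1 + rho N ^ N) + dd N * (1 - rho N ^ N)"
        using rho_props(1)[OF N] unfolding rho_props(2)[OF N, symmetric] dd_def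
        by (simp add: b field_simps)
      then show ?thesis
        using nz by (simp add: green_def divide_simps)
    qed
    ultimately show ?thesis using p m dvd True by simp
  next
    case False
    have "cyclic_green N (m - 1) = green N (k - 1)"
      using shift[of "-1"] cyclic_green_of_nat[of "k - 1" N] k False by (simp add: of_nat_diff)
    then show ?thesis
      using green_recurrence[OF N _ k(1)] p m dvd False by simp
  qed
qed

text \<open>Applying the first-order relation \<open>A G = tau N * G + \<delta>\<close> twice and
  using \<open>tau_quadratic\<close> leaves only source terms. Their coefficients are real except
  for \<open>tau N + 1\<close> at \<open>m\<close>, so the imaginary part keeps a single source of
  strength \<open>Im (tau N)\<close>.\<close>

lemma Im_cyclic_green_recurrence:
  fixes m :: int
  assumes N: "N \<ge> 7"
  defines "h \<equiv> \<lambda>m. Im (cyclic_green N m)"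
  shows "(real N - 4) * h m + h (m - 1) + h (m + 1) + h (m - 2) + h (m + 2) =
    Im (tau N) * of_bool (int N dvd m)"
proof -
  let ?G = "cyclic_green N"
  define \<delta> :: "int \<Rightarrow> complex" where "\<delta> m = of_bool (int N dvd m)" for m
  have rec: "?G (m + 1) + ?G (m - 1) = tau N * ?G m + \<delta> m" for m
    using cyclic_green_recurrence[OF N] by (simp add: \<delta>_def)
  have r1: "?G (m + 2) + ?G m = tau N * ?G (m + 1) + \<delta> (m + 1)"
    using rec[of "m + 1"] by (simp add: add.assoc)
  have r2: "?G m + ?G (m - 2) = tau N * ?G (m - 1) + \<delta> (m - 1)"
    using rec[of "m - 1"] by (simp add: algebra_simps)
  have "(of_nat N - 4) * ?G m + ?G (m - 1) + ?G (m + 1) + ?G (m - 2) + ?G (m + 2) =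
    (tau N + 1) * \<delta> m + \<delta> (m + 1) + \<delta> (m - 1)"
  proof -
    have "?G (m + 1) = tau N * ?G m + \<delta> m - ?G (m - 1)"
      and "?G (m + 2) = tau N * ?G (m + 1) + \<delta> (m + 1) - ?G m"
      and "?G (m - 2) = tau N * ?G (m - 1) + \<delta> (m - 1) - ?G m"
      using rec[of m] r1 r2 by (simp_all add: eq_diff_eq add.commute)
    note G = this
    have "(of_nat N - 4) * ?G m + ?G (m - 1) + ?G (m + 1) + ?G (m - 2) + ?G (m + 2) =
      (tau N ^ 2 + tau N + of_nat N - 6) * ?G m + ((tau N + 1) * \<delta> m + \<delta> (m + 1) + \<delta> (m - 1))"
      by (simp only: G) (simp add: algebra_simps power2_eq_square)
    then show ?thesis by (simp add: tau_quadratic[OF N])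
  qed
  from arg_cong[OF this, of Im] show ?thesis
    by (simp add: h_def \<delta>_def)
qed

section \<open>From the Green function to Pisa and Bejaia numbers\<close>

lemma CC_eq_green: "CC N = (1 + rho N ^ N) / (dd N * (1 - rho N ^ N))" if "N \<ge> 7"
proof -
  \<comment> \<open>The inverse powers cancel in this sum.\<close>
  have e: "pisa N N + dd N * bejaia N N = 2 * rho N ^ N"
    using dd_nonzero[OF that] by (simp add: pisa_def bejaia_def)
  have "CC N = (2 + (pisa N N + dd N * bejaia N N)) / (dd N * (2 - (pisa N N + dd N * bejaia N N)))"
    by (simp add: CC_def algebra_simps)
  also have "\<dots> = (2 * (1 + rho N ^ N)) / (2 * (dd N * (1 - rho N ^ N)))"
    unfolding e by (simp add: algebra_simps)
  also have "\<dots> = (1 + rho N ^ N) / (dd N * (1 - rho N ^ N))"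
    by (rule mult_divide_mult_cancel_left) simp
  finally show ?thesis .
qed

lemma green_eq_pisa_bejaia:
  assumes N: "N \<ge> 7" and l: "l \<le> N"
  shows "green N l = CC N / 2 * pisa N l + 1 / 2 * bejaia N l"
proof -
  have nz: "dd N \<noteq> 0" "1 - rho N ^ N \<noteq> 0" "rho N \<noteq> 0"
    using dd_nonzero[OF N] rho_power_neq_1[OF N] rho_props(1)[OF N] by auto
  \<comment> \<open>With \<open>q = rho N ^ N\<close>, the coefficients of \<open>rho N ^ l\<close>
    and \<open>inverse (rho N) ^ l\<close> in \<open>green\<close> are 1 and \<open>q\<close> over
    \<open>dd N * (1 - q)\<close>; their half-sum is \<open>CC N / 2\<close> and their
    half-difference \<open>1 / (2 * dd N)\<close>.\<close>
  have "rho N ^ (N - l) = rho N ^ N * inverse (rho N) ^ l"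
    using l nz by (simp add: power_diff power_inverse field_simps)
  then show ?thesis
    using nz unfolding green_def CC_eq_green[OF N] pisa_def bejaia_def
    by (simp add: divide_simps) (simp add: algebra_simps)
qed

theorem theorem1p1:
  fixes N l :: nat
  assumes "odd N" and "N \<ge> 7"
    and "1 \<le> l" and "real l \<le> real N / 2 - 1"
  shows "R2 N l = 4 / sqrt (4 * real N - 25) *
           Im (CC N - CC N / 2 * pisa N l - 1 / 2 * bejaia N l)"
proof -
  note N = \<open>N \<ge> 7\<close>
  have l: "l < N" using assms by linarith
  define t where "t = Im (tau N)"
  have t: "t = sqrt (4 * real N - 25) / 2" "t \<noteq> 0"
    using N by (auto simp: t_def tau_def)
  \<comment> \<open>Dividing by \<open>t\<close> scales the source of
    \<open>Im_cyclic_green_recurrence\<close> to 1, so the circulant matrix \<open>K\<close> inverts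
    \<open>L + J\<close>.\<close>
  define h where "h m = Im (cyclic_green N m) / t" for m
  define K where "K = mat N N (\<lambda>(x, y). h (int x - int y))"
  have K: "K \<in> carrier_mat N N" by (simp add: K_def)
  let ?M = "laplacian_mat N (adj_G2 N) + ones_mat N"
  have M: "?M \<in> carrier_mat N N" by simp
  have "?M * K = 1\<^sub>m N"
  proof (rule eq_matI)
    fix x y assume "x < dim_row (1\<^sub>m N :: real mat)" "y < dim_col (1\<^sub>m N :: real mat)"
    then have xy: "x < N" "y < N" by auto
    have "h (m mod int N - int y) = h (m - int y)" for m
      by (simp add: h_def cyclic_green_def mod_diff_left_eq)
    then have "(\<Sum>k<N. ?M $$ (x, k) * h (int k - int y)) =
        (real N - 4) * h (int x - int y) + h (int x - 1 - int y) + h (int x + 1 - int y)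
        + h (int x - 2 - int y) + h (int x + 2 - int y)"
      using sum_shifted_laplacian_G2[OF N xy(1), of "\<lambda>m. h (m - int y)"] by blast
    also have "\<dots> = of_bool (int N dvd int x - int y)"
      using Im_cyclic_green_recurrence[OF N, of "int x - int y"] t(2)
      unfolding h_def t_def[symmetric] by (simp add: field_simps)
    also have "int N dvd int x - int y \<longleftrightarrow> x = y"
      using xy by (simp flip: mod_eq_dvd_iff)
    finally have "(\<Sum>k<N. ?M $$ (x, k) * h (int k - int y)) = of_bool (x = y)" .
    then show "(?M * K) $$ (x, y) = 1\<^sub>m N $$ (x, y)"
      using xy M by (simp add: scalar_prod_def lessThan_atLeast0 K_def)
  qed (use M K in auto)
  then have "R2 N l = K $$ (0, 0) - K $$ (0, l) - K $$ (l, 0) + K $$ (l, l)"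
    unfolding R2_def using l N K
    by (intro effective_resistance_shifted_inverse) (simp_all add: adj_G2_sym)
  \<comment> \<open>Both diagonal entries are \<open>h 0\<close>, and the off-diagonal ones agree
    because \<open>green\<close> is symmetric under \<open>k\<close> to
    \<open>N - k\<close>.\<close>
  also have "\<dots> = 2 / t * Im (green N 0 - green N l)"
    using l t(2) cyclic_green_of_nat[of l N] cyclic_green_of_nat[of 0 N] cyclic_green_minus_of_nat[of l N]
    by (simp add: K_def h_def field_simps)
  also have "green N 0 = CC N" using CC_eq_green[OF N] by (simp add: green_def)
  also have "green N l = CC N / 2 * pisa N l + 1 / 2 * bejaia N l"
    using green_eq_pisa_bejaia[OF N] l by simp
  finally show ?thesis by (simp add: t(1) diff_diff_eq)
qed

end
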